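(* Let $\Omega \subset \mathbb{R}^2$ denote an open domain. Assume that two $\mathcal{C}^1$ functions $f:\Omega\to\mathbb{R}$ and $g:\Omega\to\mathbb{R}$ satisfy the following three conditions: $$\nabla f(x,y)\cdot\nabla g(x,y)=0,\qquad \Vert\nabla f(x,y)\Vert>0,\qquad \Vert\nabla g(x,y)\Vert>0 .$$ Suppose the given $\mathcal{C}^1$ parameterized curve $\mathbf{X}_*$ connecting from $(x_1,y_1)\in\Omega$ to $(x_2,y_2)\in\Omega$ lies in the level curve $$C_*=\{(x,y)\in\Omega\subset\mathbb{R}^2 : g(x,y)=g(x_1,y_1)=g(x_2,y_2)\}.$$ Then $\mathbf{X}_*$ becomes the geodesic with respect to the conformal metric $\Vert\nabla f(x,y)\Vert^2(dx^2+dy^2)$. Moreover, for any $\mathcal{C}^1$ parameterized curve $\mathbf{X}\subset\Omega$ connecting from $(x_1,y_1)$ to $(x_2,y_2)$, we have the inequality $$\int_{\mathbf{X}}\Vert\nabla f(x,y)\Vert\,ds\;\ge\;\int_{\mathbf{X}_*}\Vert\nabla f(x,y)\Vert\,ds .$$ In other words, the curve $\mathbf{X}_*$ becomes a weighted length-minimizer with respect to the density $\Vert\nabla f(x,y)\Vert$.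
   Context: Here $\nabla$, $\cdot$ and $\Vert\cdot\Vert$ are the Euclidean gradient, inner product and norm on $\mathbb{R}^2$, and $ds$ is the Euclidean arc-length element. The integral $\int_\gamma \Vert\nabla f\Vert\,ds$ is the weighted length of a curve $\gamma$ with respect to the density $\Vert\nabla f\Vert$, that is, its length in the conformal metric $\Vert\nabla f\Vert^2(dx^2+dy^2)$.
   Formalization: The given C¹ curve X_* is additionally assumed regular (nonvanishing velocity), since a C¹ curve that stops and backtracks along the level curve is not length-minimizing; "geodesic" means locally distance-realizing at constant speed after a C¹ change of parameter. *)

theory Defs
  imports "HOL-Analysis.Analysis"
begin

definition grad :: "(real^2 \<Rightarrow> real) \<Rightarrow> real^2 \<Rightarrow> real^2" where
  "grad f p = (\<chi> i. frechet_derivative f (at p) (axis i 1))"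

definition C1_function_on :: "(real^2) set \<Rightarrow> (real^2 \<Rightarrow> real) \<Rightarrow> bool" where
  "C1_function_on \<Omega> f \<longleftrightarrow> (\<forall>p\<in>\<Omega>. f differentiable (at p)) \<and> continuous_on \<Omega> (grad f)"

text \<open>
  Derivatives along a curve are taken within the parameter interval, hence one-sided at its
  end points, so that the values of the function outside the interval are irrelevant.
\<close>

definition velocity :: "real \<Rightarrow> real \<Rightarrow> (real \<Rightarrow> 'a::real_normed_vector) \<Rightarrow> real \<Rightarrow> 'a" where
  "velocity a b X t = vector_derivative X (at t within {a..b})"

definition C1_curve :: "real \<Rightarrow> real \<Rightarrow> (real \<Rightarrow> 'a::real_normed_vector) \<Rightarrow> bool" where
  "C1_curve a b X \<longleftrightarrow> a < b \<and>
     (\<forall>t\<in>{a..b}. X differentiable (at t within {a..b})) \<and>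
     continuous_on {a..b} (velocity a b X)"

definition regular_C1_curve :: "real \<Rightarrow> real \<Rightarrow> (real \<Rightarrow> 'a::real_normed_vector) \<Rightarrow> bool" where
  "regular_C1_curve a b X \<longleftrightarrow> C1_curve a b X \<and> (\<forall>t\<in>{a..b}. velocity a b X t \<noteq> 0)"

definition C1_curve_connecting ::
  "(real^2) set \<Rightarrow> real^2 \<Rightarrow> real^2 \<Rightarrow> real \<Rightarrow> real \<Rightarrow> (real \<Rightarrow> real^2) \<Rightarrow> bool" where
  "C1_curve_connecting \<Omega> p q a b X \<longleftrightarrow>
     C1_curve a b X \<and> X ` {a..b} \<subseteq> \<Omega> \<and> X a = p \<and> X b = q"

definition weighted_length ::
  "(real^2 \<Rightarrow> real) \<Rightarrow> real \<Rightarrow> real \<Rightarrow> (real \<Rightarrow> real^2) \<Rightarrow> real" where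
  "weighted_length \<rho> a b X = integral {a..b} (\<lambda>t. \<rho> (X t) * norm (velocity a b X t))"

type_synonym metric_tensor = "real^2 \<Rightarrow> real^2 \<Rightarrow> real^2 \<Rightarrow> real"

text \<open>The metric \<open>\<mu>(x,y) (dx\<^sup>2 + dy\<^sup>2)\<close>.\<close>

definition conformal_metric :: "(real^2 \<Rightarrow> real) \<Rightarrow> metric_tensor" where
  "conformal_metric \<mu> p u v = \<mu> p * (u \<bullet> v)"

definition riem_length :: "metric_tensor \<Rightarrow> real \<Rightarrow> real \<Rightarrow> (real \<Rightarrow> real^2) \<Rightarrow> real" where
  "riem_length G a b X =
     integral {a..b} (\<lambda>t. sqrt (G (X t) (velocity a b X t) (velocity a b X t)))"

text \<open>
  The competing curves need not be regular. A piecewise \<open>C\<^sup>1\<close> curve can be reparametrized, with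
  zero speed at its corners, to a \<open>C\<^sup>1\<close> curve, so this is the usual Riemannian distance.
\<close>

definition riem_dist :: "metric_tensor \<Rightarrow> (real^2) set \<Rightarrow> real^2 \<Rightarrow> real^2 \<Rightarrow> real" where
  "riem_dist G \<Omega> p q = Inf {riem_length G a b X | a b X. C1_curve_connecting \<Omega> p q a b X}"

text \<open>
  Here the metric coefficients are only continuous, so there are no Christoffel symbols and no
  geodesic equation. A geodesic is a curve of constant positive speed that locally realizes
  the Riemannian distance.
\<close>

definition geodesic ::
  "metric_tensor \<Rightarrow> (real^2) set \<Rightarrow> real \<Rightarrow> real \<Rightarrow> (real \<Rightarrow> real^2) \<Rightarrow> bool" where
  "geodesic G \<Omega> a b c \<longleftrightarrow> C1_curve a b c \<and> c ` {a..b} \<subseteq> \<Omega> \<and>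
     (\<exists>v>0. \<forall>t\<in>{a..b}. \<exists>e>0. \<forall>s\<in>{a..b}. \<forall>s'\<in>{a..b}.
        \<bar>s - t\<bar> < e \<longrightarrow> \<bar>s' - t\<bar> < e \<longrightarrow> riem_dist G \<Omega> (c s) (c s') = v * \<bar>s - s'\<bar>)"

text \<open>
  A curve with an arbitrary parametrization is a geodesic if an orientation preserving
  \<open>C\<^sup>1\<close> change of parameter \<open>\<phi>\<close> turns it into one in the sense above.
\<close>

definition geodesic_up_to_param ::
  "metric_tensor \<Rightarrow> (real^2) set \<Rightarrow> real \<Rightarrow> real \<Rightarrow> (real \<Rightarrow> real^2) \<Rightarrow> bool" where
  "geodesic_up_to_param G \<Omega> a b X \<longleftrightarrow>
     (\<exists>(\<phi>::real \<Rightarrow> real) c. C1_curve a b \<phi> \<and> (\<forall>t\<in>{a..b}. velocity a b \<phi> t > 0) \<and>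
        geodesic G \<Omega> (\<phi> a) (\<phi> b) c \<and> (\<forall>t\<in>{a..b}. X t = c (\<phi> t)))"

end

theory Submission
  imports Defs
begin

text \<open>
  The one-form \<open>df\<close> calibrates the level curves of \<open>g\<close>. By Cauchy--Schwarz,
  \<open>\<bar>\<nabla>f \<bullet> X'\<bar> \<le> \<parallel>\<nabla>f\<parallel> \<parallel>X'\<parallel>\<close>, so the fundamental theorem of calculus shows that a curve whose end
  points have \<open>f\<close>-values \<open>u\<close> and \<open>v\<close> has weighted length at least \<open>\<bar>v - u\<bar>\<close>
  (\<open>weighted_length_ge\<close>). On a curve where \<open>g\<close> is constant, \<open>\<nabla>f\<close> and \<open>X'\<close> are both orthogonal to
  \<open>\<nabla>g \<noteq> 0\<close>; in the plane this makes them parallel (\<open>abs_inner_eq_if_common_normal\<close>), and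
  Cauchy--Schwarz is an equality. If that curve is regular, then \<open>(f \<circ> X)'\<close> never vanishes and by
  continuity keeps one sign \<open>\<sigma> = \<plusminus>1\<close>; the weighted length is then exactly the absolute
  difference of the end values of \<open>f\<close> (\<open>weighted_length_eq\<close>), and the curve is minimizing.

  The same computation applies to every subarc, and it says that \<open>\<sigma> f\<close> is an arc-length parameter of
  the curve in the conformal metric. Parametrized by \<open>\<phi> = \<sigma> f \<circ> X\<close>, the curve realizes
  the Riemannian distance between any two of its points (\<open>riem_dist_unit_speed_curve\<close>), hence is a
  geodesic.
\<close>

section \<open>One-sided calculus on parameter intervals\<close>

lemma velocity_eqI:
  fixes X :: "real \<Rightarrow> 'a::euclidean_space"
  assumes "a < b" and "t \<in> {a..b}" and "(X has_vector_derivative v) (at t within {a..b})"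
  shows "velocity a b X t = v"
  unfolding velocity_def using assms by (rule vector_derivative_within_closed_interval)

lemma C1_curve_has_vector_derivative:
  assumes "C1_curve a b X" and "t \<in> {a..b}"
  shows "(X has_vector_derivative velocity a b X t) (at t within {a..b})"
  using assms unfolding C1_curve_def velocity_def by (simp add: vector_derivative_works)

lemma C1_curve_continuous_on: "C1_curve a b X \<Longrightarrow> continuous_on {a..b} X"
  by (meson C1_curve_has_vector_derivative has_vector_derivative_continuous
      continuous_on_eq_continuous_within)

lemma C1_curveI:
  fixes X :: "real \<Rightarrow> 'a::euclidean_space"
  assumes "a < b"
    and deriv: "\<And>t. t \<in> {a..b} \<Longrightarrow> (X has_vector_derivative V t) (at t within {a..b})"
    and "continuous_on {a..b} V"
  shows "C1_curve a b X"
proof -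
  have "continuous_on {a..b} (velocity a b X) \<longleftrightarrow> continuous_on {a..b} V"
    using assms velocity_eqI by (intro continuous_on_cong refl) blast
  with assms show ?thesis
    unfolding C1_curve_def by (blast intro: differentiableI_vector)
qed

lemma strict_mono_on_if_velocity_pos:
  fixes \<phi> :: "real \<Rightarrow> real"
  assumes "C1_curve a b \<phi>" and "\<forall>t\<in>{a..b}. velocity a b \<phi> t > 0"
  shows "strict_mono_on {a..b} \<phi>"
proof (rule strict_mono_onI)
  fix r s assume rs: "r \<in> {a..b}" "s \<in> {a..b}" "r < s"
  show "\<phi> r < \<phi> s"
  proof (rule DERIV_pos_imp_increasing_open[OF \<open>r < s\<close>])
    fix x assume x: "r < x" "x < s"
    then have "(\<phi> has_vector_derivative velocity a b \<phi> x) (at x within {a..b})"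
      using rs assms(1) by (intro C1_curve_has_vector_derivative) auto
    moreover have "at x within {a..b} = at x"
      using rs x by (intro at_within_Icc_at) auto
    ultimately show "\<exists>y. DERIV \<phi> x :> y \<and> y > 0"
      using rs x assms(2)
      by (intro exI[of _ "velocity a b \<phi> x"])
        (auto simp: has_real_derivative_iff_has_vector_derivative)
  next
    show "continuous_on {r..s} \<phi>"
      using rs by (intro continuous_on_subset[OF C1_curve_continuous_on[OF assms(1)]]) auto
  qed
qed

text \<open>
  The derivative of the inverse relative to a set, so that the end points of a parameter interval
  are covered: the difference quotients of the inverse are the reciprocals of those of the
  function, and continuity of the inverse carries the limit over.
\<close>

lemma has_field_derivative_inverse_within:
  fixes \<phi> \<psi> :: "'a::real_normed_field \<Rightarrow> 'a"
  assumes deriv: "(\<phi> has_field_derivative d) (at (\<psi> y) within \<psi> ` J)" and "d \<noteq> 0"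
    and "y \<in> J" and cont: "continuous_on J \<psi>"
    and inv: "\<And>z. z \<in> J \<Longrightarrow> \<phi> (\<psi> z) = z"
  shows "(\<psi> has_field_derivative inverse d) (at y within J)"
proof -
  have "filterlim \<psi> (at (\<psi> y) within \<psi> ` J) (at y within J)"
    unfolding filterlim_at
  proof
    show "(\<psi> \<longlongrightarrow> \<psi> y) (at y within J)"
      using cont \<open>y \<in> J\<close> by (simp add: continuous_on_def)
    show "\<forall>\<^sub>F z in at y within J. \<psi> z \<in> \<psi> ` J \<and> \<psi> z \<noteq> \<psi> y"
      using inv \<open>y \<in> J\<close> by (auto simp: eventually_at_filter intro!: always_eventually) metis
  qed
  from filterlim_compose[OF deriv[unfolded has_field_derivative_iff] this]
  have "((\<lambda>z. inverse ((\<phi> (\<psi> z) - \<phi> (\<psi> y)) / (\<psi> z - \<psi> y))) \<longlongrightarrow> inverse d) (at y within J)"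
    using \<open>d \<noteq> 0\<close> by (rule tendsto_inverse)
  moreover have "\<forall>\<^sub>F z in at y within J.
      inverse ((\<phi> (\<psi> z) - \<phi> (\<psi> y)) / (\<psi> z - \<psi> y)) = (\<psi> z - \<psi> y) / (z - y)"
    using inv \<open>y \<in> J\<close> by (auto simp: eventually_at_filter intro!: always_eventually)
  ultimately show ?thesis
    unfolding has_field_derivative_iff by (rule Lim_transform_eventually)
qed

lemma C1_parameter_change_inverse:
  fixes \<phi> :: "real \<Rightarrow> real"
  assumes C1: "C1_curve a b \<phi>" and pos: "\<forall>t\<in>{a..b}. velocity a b \<phi> t > 0"
  obtains \<psi> where "\<And>t. t \<in> {a..b} \<Longrightarrow> \<psi> (\<phi> t) = t"
    and "\<And>y. y \<in> {\<phi> a..\<phi> b} \<Longrightarrow> \<psi> y \<in> {a..b} \<and> \<phi> (\<psi> y) = y"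
    and "\<And>y. y \<in> {\<phi> a..\<phi> b} \<Longrightarrow>
      (\<psi> has_vector_derivative inverse (velocity a b \<phi> (\<psi> y))) (at y within {\<phi> a..\<phi> b})"
    and "continuous_on {\<phi> a..\<phi> b} \<psi>"
    and "\<phi> a < \<phi> b"
proof -
  have ab: "a < b" using C1 by (simp add: C1_curve_def)
  have mono: "strict_mono_on {a..b} \<phi>" using assms by (rule strict_mono_on_if_velocity_pos)
  then have inj: "inj_on \<phi> {a..b}" by (rule strict_mono_on_imp_inj_on)
  have cont: "continuous_on {a..b} \<phi>" using C1 by (rule C1_curve_continuous_on)
  have img: "\<phi> ` {a..b} = {\<phi> a..\<phi> b}"
  proof
    show "\<phi> ` {a..b} \<subseteq> {\<phi> a..\<phi> b}"
      using ab by (auto intro!: strict_mono_on_leD[OF mono])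
    show "{\<phi> a..\<phi> b} \<subseteq> \<phi> ` {a..b}"
      using ab by (force dest: IVT'[OF _ _ _ cont])
  qed
  define \<psi> where "\<psi> = inv_into {a..b} \<phi>"
  have left: "\<psi> (\<phi> t) = t" if "t \<in> {a..b}" for t
    unfolding \<psi>_def using inj that by (rule inv_into_f_f)
  have right: "\<psi> y \<in> {a..b} \<and> \<phi> (\<psi> y) = y" if "y \<in> {\<phi> a..\<phi> b}" for y
    using that unfolding \<psi>_def img[symmetric] by (metis inv_into_into f_inv_into_f)
  have cont_inv: "continuous_on {\<phi> a..\<phi> b} \<psi>"
    using continuous_on_inv[OF cont compact_Icc] left by (simp add: img)
  have img_inv: "\<psi> ` {\<phi> a..\<phi> b} = {a..b}"
    using left unfolding img[symmetric] by force
  have deriv: "(\<psi> has_vector_derivative inverse (velocity a b \<phi> (\<psi> y))) (at y within {\<phi> a..\<phi> b})"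
    if y: "y \<in> {\<phi> a..\<phi> b}" for y
    unfolding has_real_derivative_iff_has_vector_derivative[symmetric]
  proof (rule has_field_derivative_inverse_within[OF _ _ y cont_inv])
    show "(\<phi> has_field_derivative velocity a b \<phi> (\<psi> y)) (at (\<psi> y) within \<psi> ` {\<phi> a..\<phi> b})"
      using C1_curve_has_vector_derivative[OF C1] right[OF y]
      by (simp add: img_inv has_real_derivative_iff_has_vector_derivative)
    show "velocity a b \<phi> (\<psi> y) \<noteq> 0"
      using pos right[OF y] by force
  qed (use right in blast)
  have "\<phi> a < \<phi> b"
    using mono ab by (auto simp: strict_mono_on_def)
  then show ?thesis using that left right deriv cont_inv by blast
qed

lemma nonvanishing_on_Icc_sign:
  fixes h :: "real \<Rightarrow> real"
  assumes cont: "continuous_on {a..b} h" and nz: "\<And>t. t \<in> {a..b} \<Longrightarrow> h t \<noteq> 0"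
  obtains \<sigma> :: real where "\<bar>\<sigma>\<bar> = 1" and "\<forall>t\<in>{a..b}. \<sigma> * h t = \<bar>h t\<bar>"
proof -
  have "(\<forall>t\<in>{a..b}. h t > 0) \<or> (\<forall>t\<in>{a..b}. h t < 0)"
  proof (rule ccontr)
    assume "\<not> ?thesis"
    then obtain s t where st: "s \<in> {a..b}" "h s < 0" "t \<in> {a..b}" "h t > 0"
      using nz by (meson linorder_neqE_linordered_idom)
    have "connected (h ` {a..b})"
      using cont by (rule connected_continuous_image) simp
    then have "0 \<in> h ` {a..b}"
      using st by (auto intro: connectedD_interval[of _ "h s" "h t"])
    then show False using nz by auto
  qed
  then show ?thesis
  proof
    assume "\<forall>t\<in>{a..b}. h t > 0"
    then show ?thesis by (intro that[of 1]) force+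
  next
    assume "\<forall>t\<in>{a..b}. h t < 0"
    then show ?thesis by (intro that[of "-1"]) force+
  qed
qed

section \<open>The weighted length bounds the variation of the potential\<close>

lemma has_derivative_grad:
  assumes "f differentiable (at p)"
  shows "(f has_derivative (\<lambda>v. grad f p \<bullet> v)) (at p)"
proof -
  let ?D = "frechet_derivative f (at p)"
  have D: "(f has_derivative ?D) (at p)"
    using assms by (simp add: frechet_derivative_works)
  then have "linear ?D" by (rule has_derivative_linear)
  have "?D v = grad f p \<bullet> v" for v
  proof -
    have "?D v = ?D (\<Sum>i\<in>UNIV. v $ i *\<^sub>R axis i 1)"
      using basis_expansion[of v] by (simp add: scalar_mult_eq_scaleR)
    also have "\<dots> = (\<Sum>i\<in>UNIV. v $ i * ?D (axis i 1))"
      using \<open>linear ?D\<close> by (simp add: linear_sum linear_cmul)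
    finally show ?thesis by (simp add: grad_def inner_vec_def mult.commute)
  qed
  then have "?D = (\<lambda>v. grad f p \<bullet> v)" by blast
  with D show ?thesis by simp
qed

lemma has_vector_derivative_along_curve:
  assumes "C1_function_on \<Omega> f" and "C1_curve a b X" and "X ` {a..b} \<subseteq> \<Omega>" and "t \<in> {a..b}"
  shows "((\<lambda>t. f (X t)) has_vector_derivative grad f (X t) \<bullet> velocity a b X t) (at t within {a..b})"
proof -
  have "(f has_derivative (\<lambda>v. grad f (X t) \<bullet> v)) (at (X t))"
    using assms by (intro has_derivative_grad) (unfold C1_function_on_def, blast)
  from has_derivative_compose[OF C1_curve_has_vector_derivative[OF assms(2,4),
        unfolded has_vector_derivative_def] this]
  show ?thesis by (simp add: has_vector_derivative_def)
qed

lemma continuous_on_grad_along_curve: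
  assumes "C1_function_on \<Omega> f" and "C1_curve a b X" and "X ` {a..b} \<subseteq> \<Omega>"
  shows "continuous_on {a..b} (\<lambda>t. grad f (X t))"
  using assms(1)
  by (intro continuous_on_compose2[OF _ C1_curve_continuous_on[OF assms(2)] assms(3)])
    (simp add: C1_function_on_def)

lemma continuous_on_velocity: "C1_curve a b X \<Longrightarrow> continuous_on {a..b} (velocity a b X)"
  by (simp add: C1_curve_def)

lemma weighted_length_ge:
  assumes f: "C1_function_on \<Omega> f" and X: "C1_curve a b X" and sub: "X ` {a..b} \<subseteq> \<Omega>"
  shows "weighted_length (\<lambda>p. norm (grad f p)) a b X \<ge> \<bar>f (X b) - f (X a)\<bar>"
proof -
  note cont = continuous_on_grad_along_curve[OF f X sub] continuous_on_velocity[OF X]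
  have "a \<le> b" using X by (simp add: C1_curve_def)
  then have FTC: "((\<lambda>t. grad f (X t) \<bullet> velocity a b X t) has_integral f (X b) - f (X a)) {a..b}"
    using has_vector_derivative_along_curve[OF f X sub] by (rule fundamental_theorem_of_calculus)
  have "norm (integral {a..b} (\<lambda>t. grad f (X t) \<bullet> velocity a b X t))
      \<le> integral {a..b} (\<lambda>t. norm (grad f (X t)) * norm (velocity a b X t))"
  proof (rule Henstock_Kurzweil_Integration.integral_norm_bound_integral)
    show "(\<lambda>t. grad f (X t) \<bullet> velocity a b X t) integrable_on {a..b}"
      using FTC by (rule has_integral_integrable)
    show "(\<lambda>t. norm (grad f (X t)) * norm (velocity a b X t)) integrable_on {a..b}"
      by (intro integrable_continuous_interval continuous_intros cont)
  qed (simp add: Cauchy_Schwarz_ineq2)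
  then show ?thesis
    using integral_unique[OF FTC] by (simp add: weighted_length_def)
qed

section \<open>Level curves of an orthogonal function attain the bound\<close>

text \<open>
  In the plane the orthogonal complement of a nonzero vector is a line, so two vectors in it are
  parallel.
\<close>

lemma abs_inner_eq_if_common_normal:
  fixes u v w :: "real^2"
  assumes "u \<bullet> w = 0" and "v \<bullet> w = 0" and "w \<noteq> 0"
  shows "\<bar>u \<bullet> v\<bar> = norm u * norm v"
proof -
  have uw: "u$1 * w$1 + u$2 * w$2 = 0" and vw: "v$1 * w$1 + v$2 * w$2 = 0"
    using assms by (simp_all add: inner_vec_def sum_2)
  define d where "d = u$1 * v$2 - u$2 * v$1"
  have "d * w$1 = v$2 * (u$1 * w$1 + u$2 * w$2) - u$2 * (v$1 * w$1 + v$2 * w$2)"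
    and "d * w$2 = u$1 * (v$1 * w$1 + v$2 * w$2) - v$1 * (u$1 * w$1 + u$2 * w$2)"
    by (simp_all add: d_def algebra_simps)
  then have "d * w$1 = 0" and "d * w$2 = 0" by (simp_all add: uw vw)
  with \<open>w \<noteq> 0\<close> have "d = 0" by (auto simp: vec_eq_iff forall_2)
  (* Lagrange's identity: the defect in Cauchy--Schwarz is the square of the determinant. *)
  have "(u \<bullet> u) * (v \<bullet> v) = (u \<bullet> v)\<^sup>2 + d\<^sup>2"
    by (simp add: d_def inner_vec_def sum_2 power2_eq_square algebra_simps)
  then have "(norm u * norm v)\<^sup>2 = (u \<bullet> v)\<^sup>2"
    using \<open>d = 0\<close> by (simp add: power_mult_distrib power2_norm_eq_inner)
  then show ?thesis
    by (simp add: power2_eq_imp_eq)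
qed

text \<open>
  Differentiating \<open>g \<circ> X = k\<close> makes \<open>\<nabla>g\<close> a common normal of \<open>\<nabla>f\<close> and the velocity.
\<close>

lemma level_curve_abs_derivative:
  assumes g: "C1_function_on \<Omega> g" and X: "C1_curve a b X" and sub: "X ` {a..b} \<subseteq> \<Omega>"
    and orth: "\<forall>p\<in>\<Omega>. grad f p \<bullet> grad g p = 0" and nz: "\<forall>p\<in>\<Omega>. grad g p \<noteq> 0"
    and level: "\<And>t. t \<in> {a..b} \<Longrightarrow> g (X t) = k" and t: "t \<in> {a..b}"
  shows "\<bar>grad f (X t) \<bullet> velocity a b X t\<bar> = norm (grad f (X t)) * norm (velocity a b X t)"
proof (rule abs_inner_eq_if_common_normal)
  have "a < b" using X by (simp add: C1_curve_def)
  have "((\<lambda>t. g (X t)) has_vector_derivative 0) (at t within {a..b})"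
    by (rule has_vector_derivative_transform[OF t _ has_vector_derivative_const]) (rule level)
  from velocity_eqI[OF \<open>a < b\<close> t this]
    velocity_eqI[OF \<open>a < b\<close> t has_vector_derivative_along_curve[OF g X sub t]]
  show "velocity a b X t \<bullet> grad g (X t) = 0" by (simp add: inner_commute)
qed (use sub t orth nz in blast)+

text \<open>
  Equality in Cauchy--Schwarz up to sign is not enough: where the curve turns back, \<open>f\<close> retraces its
  values while the length grows. Hence one sign \<open>\<sigma>\<close> has to serve all parameters.
\<close>

lemma weighted_length_eq:
  assumes f: "C1_function_on \<Omega> f" and X: "C1_curve a b X" and sub: "X ` {a..b} \<subseteq> \<Omega>"
    and "\<bar>\<sigma>\<bar> = 1"
    and speed: "\<And>t. t \<in> {a..b} \<Longrightarrow>
      \<sigma> * (grad f (X t) \<bullet> velocity a b X t) = norm (grad f (X t)) * norm (velocity a b X t)"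
  shows "weighted_length (\<lambda>p. norm (grad f p)) a b X = \<bar>f (X b) - f (X a)\<bar>"
proof -
  have "a \<le> b" using X by (simp add: C1_curve_def)
  then have "((\<lambda>t. grad f (X t) \<bullet> velocity a b X t) has_integral f (X b) - f (X a)) {a..b}"
    using has_vector_derivative_along_curve[OF f X sub] by (rule fundamental_theorem_of_calculus)
  from has_integral_mult_right[OF this, of \<sigma>]
  have "((\<lambda>t. norm (grad f (X t)) * norm (velocity a b X t))
      has_integral \<sigma> * (f (X b) - f (X a))) {a..b}"
    by (rule has_integral_eq[rotated]) (rule speed)
  then have len: "weighted_length (\<lambda>p. norm (grad f p)) a b X = \<sigma> * (f (X b) - f (X a))"
    unfolding weighted_length_def by (rule integral_unique)
  then have "\<sigma> * (f (X b) - f (X a)) \<ge> 0"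
    using weighted_length_ge[OF f X sub] by linarith
  with len \<open>\<bar>\<sigma>\<bar> = 1\<close> show ?thesis
    by (metis abs_mult abs_of_nonneg mult_1)
qed

section \<open>Arc-length parametrization and the Riemannian distance\<close>

lemma riem_length_conformal:
  "riem_length (conformal_metric (\<lambda>p. (norm (grad f p))\<^sup>2)) a b X
    = weighted_length (\<lambda>p. norm (grad f p)) a b X"
  by (simp add: riem_length_def conformal_metric_def weighted_length_def real_sqrt_mult
      norm_eq_sqrt_inner)

text \<open>
  The arc of \<open>c\<close> from \<open>s\<close> to \<open>s'\<close>, run over \<open>[0,1]\<close>, has constant weighted speed
  \<open>\<bar>s' - s\<bar>\<close> and is therefore a competitor of exactly the length that \<open>weighted_length_ge\<close> gives as
  a lower bound. This affine parametrization covers \<open>s < s'\<close>, the reversed arc \<open>s > s'\<close>, and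
  the constant curve \<open>s = s'\<close> at once.
\<close>

lemma riem_dist_unit_speed_curve:
  assumes f: "C1_function_on \<Omega> f" and c: "C1_curve A B c" and sub: "c ` {A..B} \<subseteq> \<Omega>"
    and unit: "\<And>t. t \<in> {A..B} \<Longrightarrow> norm (grad f (c t)) * norm (velocity A B c t) = 1"
    and f_c: "\<And>t. t \<in> {A..B} \<Longrightarrow> f (c t) = \<sigma> * t" and \<sigma>: "\<bar>\<sigma>\<bar> = 1"
    and s: "s \<in> {A..B}" and s': "s' \<in> {A..B}"
  shows "riem_dist (conformal_metric (\<lambda>p. (norm (grad f p))\<^sup>2)) \<Omega> (c s) (c s') = \<bar>s - s'\<bar>"
proof -
  define l where "l t = s + t * (s' - s)" for t
  have l_ran: "l t \<in> {A..B}" if "t \<in> {0..1}" for t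
  proof -
    have "l t = (1 - t) *\<^sub>R s + t *\<^sub>R s'" by (simp add: l_def algebra_simps)
    then show ?thesis
      using convexD_alt[OF convex_real_interval(5) s s'] that by simp
  qed
  have l_deriv: "(l has_vector_derivative (s' - s)) (at t within {0..1})" for t
    unfolding l_def has_real_derivative_iff_has_vector_derivative[symmetric]
    by (auto intro!: derivative_eq_intros)
  have l_cont: "continuous_on {0..1} l"
    unfolding l_def by (intro continuous_intros)
  define Y where "Y = c \<circ> l"
  have Y_deriv: "(Y has_vector_derivative (s' - s) *\<^sub>R velocity A B c (l t)) (at t within {0..1})"
    if "t \<in> {0..1}" for t
    unfolding Y_def
    by (rule vector_diff_chain_within[OF l_deriv has_vector_derivative_within_subset])
      (use c l_ran that in \<open>auto intro: C1_curve_has_vector_derivative\<close>)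
  have "C1_curve 0 1 Y"
  proof (rule C1_curveI[OF _ Y_deriv])
    show "continuous_on {0..1} (\<lambda>t. (s' - s) *\<^sub>R velocity A B c (l t))"
      using l_ran
      by (intro continuous_intros
          continuous_on_compose2[OF continuous_on_velocity[OF c] l_cont]) auto
  qed auto
  then have Y: "C1_curve_connecting \<Omega> (c s) (c s') 0 1 Y"
    using l_ran sub by (auto simp: C1_curve_connecting_def Y_def l_def)
  have "weighted_length (\<lambda>p. norm (grad f p)) 0 1 Y = integral {0..1} (\<lambda>t::real. \<bar>s - s'\<bar>)"
    unfolding weighted_length_def
  proof (rule Henstock_Kurzweil_Integration.integral_cong)
    fix t :: real assume t: "t \<in> {0..1}"
    then have "velocity 0 1 Y t = (s' - s) *\<^sub>R velocity A B c (l t)"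
      by (intro velocity_eqI Y_deriv) auto
    then have "norm (grad f (Y t)) * norm (velocity 0 1 Y t)
        = \<bar>s' - s\<bar> * (norm (grad f (c (l t))) * norm (velocity A B c (l t)))"
      by (simp add: Y_def)
    with unit[OF l_ran[OF t]] show "norm (grad f (Y t)) * norm (velocity 0 1 Y t) = \<bar>s - s'\<bar>"
      by simp
  qed
  then have Y_len: "weighted_length (\<lambda>p. norm (grad f p)) 0 1 Y = \<bar>s - s'\<bar>" by simp
  have lower: "\<bar>s - s'\<bar> \<le> weighted_length (\<lambda>p. norm (grad f p)) a b X"
    if "C1_curve_connecting \<Omega> (c s) (c s') a b X" for a b X
  proof -
    have "\<bar>s - s'\<bar> = \<bar>f (c s') - f (c s)\<bar>"
      using f_c[OF s] f_c[OF s'] \<sigma>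
      by (simp add: right_diff_distrib[symmetric] abs_mult abs_minus_commute)
    then show ?thesis
      using that weighted_length_ge[OF f, of a b X] by (simp add: C1_curve_connecting_def)
  qed
  show ?thesis
    unfolding riem_dist_def riem_length_conformal
    by (rule cInf_eq_minimum) (use Y Y_len lower in force)+
qed

text \<open>
  The weighted speed \<open>w\<close> of \<open>X\<close> is the derivative of \<open>\<phi> = \<sigma> f \<circ> X\<close>, so \<open>X \<circ> \<phi>\<^sup>-\<^sup>1\<close> has unit weighted
  speed and \<open>f\<close> restricted to it is \<open>\<sigma>\<close> times the parameter.
\<close>

lemma geodesic_up_to_param_if_calibrated:
  assumes f: "C1_function_on \<Omega> f" and X: "C1_curve a b X" and sub: "X ` {a..b} \<subseteq> \<Omega>"
    and \<sigma>: "\<bar>\<sigma>\<bar> = 1"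
    and speed: "\<And>t. t \<in> {a..b} \<Longrightarrow>
      \<sigma> * (grad f (X t) \<bullet> velocity a b X t) = norm (grad f (X t)) * norm (velocity a b X t)"
    and pos: "\<And>t. t \<in> {a..b} \<Longrightarrow> norm (grad f (X t)) * norm (velocity a b X t) > 0"
  shows "geodesic_up_to_param (conformal_metric (\<lambda>p. (norm (grad f p))\<^sup>2)) \<Omega> a b X"
proof -
  have ab: "a < b" using X by (simp add: C1_curve_def)
  define w where "w t = norm (grad f (X t)) * norm (velocity a b X t)" for t
  define \<phi> where "\<phi> t = \<sigma> * f (X t)" for t
  have \<phi>_deriv: "(\<phi> has_vector_derivative w t) (at t within {a..b})" if t: "t \<in> {a..b}" for t
    using bounded_linear.has_vector_derivative[OF bounded_linear_mult_right
        has_vector_derivative_along_curve[OF f X sub t], of \<sigma>] speed[OF t]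
    by (simp add: \<phi>_def[abs_def] w_def)
  have w_cont: "continuous_on {a..b} w"
    unfolding w_def
    by (intro continuous_intros continuous_on_grad_along_curve[OF f X sub] continuous_on_velocity X)
  have \<phi>: "C1_curve a b \<phi>" using ab \<phi>_deriv w_cont by (rule C1_curveI)
  have \<phi>_vel: "velocity a b \<phi> t = w t" if "t \<in> {a..b}" for t
    using velocity_eqI[OF ab that \<phi>_deriv[OF that]] .
  have \<phi>_pos: "\<forall>t\<in>{a..b}. velocity a b \<phi> t > 0"
    using \<phi>_vel pos by (simp add: w_def)
  obtain \<psi> where left: "\<And>t. t \<in> {a..b} \<Longrightarrow> \<psi> (\<phi> t) = t"
    and right: "\<And>y. y \<in> {\<phi> a..\<phi> b} \<Longrightarrow> \<psi> y \<in> {a..b} \<and> \<phi> (\<psi> y) = y"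
    and \<psi>_deriv: "\<And>y. y \<in> {\<phi> a..\<phi> b} \<Longrightarrow>
      (\<psi> has_vector_derivative inverse (velocity a b \<phi> (\<psi> y))) (at y within {\<phi> a..\<phi> b})"
    and \<psi>_cont: "continuous_on {\<phi> a..\<phi> b} \<psi>" and AB: "\<phi> a < \<phi> b"
    using C1_parameter_change_inverse[OF \<phi> \<phi>_pos] by metis
  define c where "c = X \<circ> \<psi>"
  define V where "V y = inverse (w (\<psi> y)) *\<^sub>R velocity a b X (\<psi> y)" for y
  have c_deriv: "(c has_vector_derivative V y) (at y within {\<phi> a..\<phi> b})"
    if y: "y \<in> {\<phi> a..\<phi> b}" for y
    unfolding c_def V_def
  proof (rule vector_diff_chain_within)
    show "(\<psi> has_vector_derivative inverse (w (\<psi> y))) (at y within {\<phi> a..\<phi> b})"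
      using \<psi>_deriv[OF y] right[OF y] \<phi>_vel by simp
    show "(X has_vector_derivative velocity a b X (\<psi> y)) (at (\<psi> y) within \<psi> ` {\<phi> a..\<phi> b})"
      by (rule has_vector_derivative_within_subset[OF C1_curve_has_vector_derivative[OF X]])
        (use right y in auto)
  qed
  have V_cont: "continuous_on {\<phi> a..\<phi> b} V"
    unfolding V_def
    using right pos
    by (intro continuous_intros continuous_on_compose2[OF w_cont \<psi>_cont]
        continuous_on_compose2[OF continuous_on_velocity[OF X] \<psi>_cont])
      (force simp: w_def)+
  have c: "C1_curve (\<phi> a) (\<phi> b) c" using AB c_deriv V_cont by (rule C1_curveI)
  have c_sub: "c ` {\<phi> a..\<phi> b} \<subseteq> \<Omega>" using right sub by (auto simp: c_def)
  have "riem_dist (conformal_metric (\<lambda>p. (norm (grad f p))\<^sup>2)) \<Omega> (c s) (c s') = \<bar>s - s'\<bar>"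
    if "s \<in> {\<phi> a..\<phi> b}" "s' \<in> {\<phi> a..\<phi> b}" for s s'
  proof (rule riem_dist_unit_speed_curve[OF f c c_sub _ _ \<sigma> that])
    fix y assume y: "y \<in> {\<phi> a..\<phi> b}"
    have "norm (grad f (c y)) * norm (velocity (\<phi> a) (\<phi> b) c y) = \<bar>inverse (w (\<psi> y))\<bar> * w (\<psi> y)"
      using velocity_eqI[OF AB y c_deriv[OF y]] by (simp add: V_def c_def w_def)
    also have "w (\<psi> y) > 0" using right[OF y] pos by (simp add: w_def)
    then have "\<bar>inverse (w (\<psi> y))\<bar> * w (\<psi> y) = 1" by simp
    finally show "norm (grad f (c y)) * norm (velocity (\<phi> a) (\<phi> b) c y) = 1" .
    have "\<sigma> * \<sigma> = 1" using \<sigma> by (metis abs_mult_self_eq mult_1)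
    moreover have "\<sigma> * f (c y) = y" using right[OF y] by (simp add: c_def \<phi>_def)
    ultimately show "f (c y) = \<sigma> * y" by (metis mult.assoc mult_1)
  qed
  (* The distance formula holds on the whole parameter interval, so any neighbourhood radius works. *)
  then have "geodesic (conformal_metric (\<lambda>p. (norm (grad f p))\<^sup>2)) \<Omega> (\<phi> a) (\<phi> b) c"
    unfolding geodesic_def using c c_sub
    by (intro conjI exI[of _ 1] ballI) (auto intro!: exI[of _ 1])
  then show ?thesis
    unfolding geodesic_up_to_param_def using \<phi> \<phi>_pos left
    by (intro exI[of _ \<phi>] exI[of _ c]) (simp add: c_def)
qed

section \<open>Level curves are minimizing geodesics\<close>

theorem theorem1:
  fixes \<Omega> :: "(real^2) set"
    and f g :: "real^2 \<Rightarrow> real"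
    and Xstar :: "real \<Rightarrow> real^2"
    and p1 p2 :: "real^2"
    and a b :: real
  assumes "open \<Omega>" and "connected \<Omega>"
    and "C1_function_on \<Omega> f" and "C1_function_on \<Omega> g"
    and "\<forall>p\<in>\<Omega>. grad f p \<bullet> grad g p = 0"
    and "\<forall>p\<in>\<Omega>. norm (grad f p) > 0"
    and "\<forall>p\<in>\<Omega>. norm (grad g p) > 0"
    and "p1 \<in> \<Omega>" and "p2 \<in> \<Omega>"
    and "regular_C1_curve a b Xstar" and "Xstar a = p1" and "Xstar b = p2"
    and "Xstar ` {a..b} \<subseteq> {p \<in> \<Omega>. g p = g p1 \<and> g p1 = g p2}"
  shows "geodesic_up_to_param (conformal_metric (\<lambda>p. (norm (grad f p))\<^sup>2)) \<Omega> a b Xstar \<and>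
    (\<forall>c d X. C1_curve_connecting \<Omega> p1 p2 c d X \<longrightarrow>
       weighted_length (\<lambda>p. norm (grad f p)) c d X
         \<ge> weighted_length (\<lambda>p. norm (grad f p)) a b Xstar)"
proof -
  have X: "C1_curve a b Xstar" and reg: "\<And>t. t \<in> {a..b} \<Longrightarrow> velocity a b Xstar t \<noteq> 0"
    using assms(10) by (simp_all add: regular_C1_curve_def)
  have sub: "Xstar ` {a..b} \<subseteq> \<Omega>" and level: "\<And>t. t \<in> {a..b} \<Longrightarrow> g (Xstar t) = g p1"
    using assms(13) by blast+
  note f = assms(3)
  define h where "h t = grad f (Xstar t) \<bullet> velocity a b Xstar t" for t
  define w where "w t = norm (grad f (Xstar t)) * norm (velocity a b Xstar t)" for t
  have abs_h: "\<bar>h t\<bar> = w t" if "t \<in> {a..b}" for t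
    unfolding h_def w_def
    by (rule level_curve_abs_derivative[OF assms(4) X sub assms(5) _ level that])
      (use assms(7) in auto)
  have w_pos: "w t > 0" if "t \<in> {a..b}" for t
  proof -
    have "Xstar t \<in> \<Omega>" using that sub by blast
    with reg[OF that] assms(6) show ?thesis by (simp add: w_def)
  qed
  have "continuous_on {a..b} h"
    unfolding h_def
    by (intro continuous_intros continuous_on_grad_along_curve[OF f X sub] continuous_on_velocity X)
  moreover have "h t \<noteq> 0" if "t \<in> {a..b}" for t
    using abs_h[OF that] w_pos[OF that] by auto
  ultimately obtain \<sigma> :: real where \<sigma>: "\<bar>\<sigma>\<bar> = 1"
    and "\<forall>t\<in>{a..b}. \<sigma> * h t = \<bar>h t\<bar>"
    using nonvanishing_on_Icc_sign by blast
  then have speed: "\<And>t. t \<in> {a..b} \<Longrightarrow> \<sigma> * h t = w t" using abs_h by simp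
  have "weighted_length (\<lambda>p. norm (grad f p)) a b Xstar = \<bar>f p2 - f p1\<bar>"
    using weighted_length_eq[OF f X sub \<sigma> speed[unfolded h_def w_def]] assms(11,12) by simp
  moreover have "\<bar>f p2 - f p1\<bar> \<le> weighted_length (\<lambda>p. norm (grad f p)) c d Y"
    if "C1_curve_connecting \<Omega> p1 p2 c d Y" for c d Y
    using that weighted_length_ge[OF f, of c d Y] by (simp add: C1_curve_connecting_def)
  ultimately show ?thesis
    using geodesic_up_to_param_if_calibrated[OF f X sub \<sigma>
        speed[unfolded h_def w_def] w_pos[unfolded w_def]]
    by simp
qed

end
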